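(* Let $p,q\ge2$ be integers, $n=p+q+1$ and $a>1$. Then the meridians and the parallels on $S_{p,q}$ are path connected.
   Context: $S_{p,q}\subset\mathbb{R}^n$ is the hypersurface $\left\{\left(\sum_{i=1}^{p+1}x_i^2-a^2\right)^2+\sum_{j=p+2}^{n}x_j^2=1\right\}$. A meridian on $S_{p,q}$ is the intersection of $S_{p,q}$ with a hyperplane $\{\sum_{i=1}^{p+1}a_ix_i=0\}$, $a_i\in\mathbb{R}$. A parallel on $S_{p,q}$ is the intersection of $S_{p,q}$ with a hyperplane $\{\sum_{j=p+2}^{n}a_jx_j-c=0\}$ for some $c\in(0,1)$, $a_j\in\mathbb{R}$. *)

theory Defs
  imports "HOL-Analysis.Analysis"
begin

text \<open>
  Here \<open>\<real>\<^sup>n\<close> is the library's \<open>Euclidean_space n\<close>: sequences vanishing from index \<open>n\<close> on, with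
  coordinates numbered from \<open>0\<close>.  The usual \<open>x\<^sub>1, \<dots>, x\<^sub>p\<^sub>+\<^sub>1\<close> are therefore \<open>x i\<close> for \<open>i < p + 1\<close>,
  and \<open>x\<^sub>p\<^sub>+\<^sub>2, \<dots>, x\<^sub>n\<close>, with \<open>n = p + q + 1\<close>, are \<open>x j\<close> for \<open>p + 1 \<le> j < p + q + 1\<close>.
\<close>

definition S_hypersurface :: "nat \<Rightarrow> nat \<Rightarrow> real \<Rightarrow> (nat \<Rightarrow> real) set" where
  "S_hypersurface p q a =
    {x \<in> topspace (Euclidean_space (p + q + 1)).
       ((\<Sum>i<p + 1. (x i)\<^sup>2) - a\<^sup>2)\<^sup>2 + (\<Sum>j=p + 1..<p + q + 1. (x j)\<^sup>2) = 1}"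

text \<open>
  The coefficients below are not all zero, since the equations have to define hyperplanes.  They
  are not normalised, so a parallel may be empty; \<open>path_connectedin\<close> holds of the empty set.
\<close>

definition is_meridian :: "nat \<Rightarrow> nat \<Rightarrow> real \<Rightarrow> (nat \<Rightarrow> real) set \<Rightarrow> bool" where
  "is_meridian p q a M \<longleftrightarrow>
    (\<exists>b :: nat \<Rightarrow> real. (\<exists>i<p + 1. b i \<noteq> 0) \<and>
       M = S_hypersurface p q a \<inter>
           {x \<in> topspace (Euclidean_space (p + q + 1)). (\<Sum>i<p + 1. b i * x i) = 0})"

definition is_parallel :: "nat \<Rightarrow> nat \<Rightarrow> real \<Rightarrow> (nat \<Rightarrow> real) set \<Rightarrow> bool" where
  "is_parallel p q a P \<longleftrightarrow>
    (\<exists>(b :: nat \<Rightarrow> real) (c :: real). 0 < c \<and> c < 1 \<and> (\<exists>j\<in>{p + 1..<p + q + 1}. b j \<noteq> 0) \<and>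
       P = S_hypersurface p q a \<inter>
           {x \<in> topspace (Euclidean_space (p + q + 1)).
              (\<Sum>j=p + 1..<p + q + 1. b j * x j) - c = 0})"

end

theory Submission
  imports Defs
begin

text \<open>
  Write a point of the hypersurface as \<open>(u, v)\<close> with \<open>u \<in> \<real>\<^bsup>p+1\<^esup>\<close> and \<open>v \<in> \<real>\<^bsup>q\<^esup>\<close>.  Its equation says
  that \<open>(t, v)\<close> with \<open>t = \<bar>u\<bar>\<^sup>2 - a\<^sup>2\<close> lies on the unit sphere of \<open>\<real>\<^bsup>q+1\<^esup>\<close>.  Since \<open>a > 1 \<ge> \<bar>t\<bar>\<close>, the
  norm of \<open>u\<close> is the positive number \<open>sqrt (a\<^sup>2 + t)\<close>, so that \<open>(\<omega>, (t, v)) \<mapsto> (sqrt (a\<^sup>2 + t) \<omega>, v)\<close> maps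
  the product of the unit spheres of \<open>\<real>\<^bsup>p+1\<^esup>\<close> and \<open>\<real>\<^bsup>q+1\<^esup>\<close> continuously onto the hypersurface.

  A homogeneous linear condition on \<open>u\<close> is the same condition on \<open>\<omega>\<close>, and a linear condition on \<open>v\<close>
  is one on \<open>(t, v)\<close> that ignores \<open>t\<close>.  A meridian or a parallel is therefore the image of a product
  of two hyperplane sections of spheres, one of the two sections being cut out by the trivial
  equation \<open>0 = 0\<close>.  Both spheres live in a space of dimension at least three, where every section of
  the unit sphere by a linear equation is path connected (\<open>path_connected_sphere_section\<close>).
\<close>

section \<open>Hyperplane sections of a sphere\<close>

text \<open>
  The vector is sought among those supported on three coordinates, where it is a vector of \<open>\<real>\<^sup>3\<close>
  orthogonal to two given ones.
\<close>

lemma unit_vector_orthogonal_to_two: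
  fixes b d :: "'i \<Rightarrow> real"
  assumes "finite I" and "3 \<le> card I"
  obtains e where "\<And>i. i \<notin> I \<Longrightarrow> e i = 0" and "(\<Sum>i\<in>I. (e i)\<^sup>2) = 1"
    and "(\<Sum>i\<in>I. b i * e i) = 0" and "(\<Sum>i\<in>I. d i * e i) = 0"
proof -
  obtain J where "J \<subseteq> I" "card J = 3"
    using obtain_subset_with_card_n[OF assms(2)] by metis
  then obtain i j k where J: "J = {i, j, k}" "i \<noteq> j" "j \<noteq> k" "i \<noteq> k"
    by (metis card_3_iff)
  define B D :: "real ^ 3" where "B = vector [b i, b j, b k]" and "D = vector [d i, d j, d k]"
  have "card {B, D} \<le> 2"
    by (simp add: card_insert_if)
  then have "dim {B, D} < DIM(real ^ 3)"
    using dim_le_card'[of "{B, D}"] by simp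
  then obtain w where w: "w \<noteq> 0" "\<And>y. y \<in> span {B, D} \<Longrightarrow> orthogonal w y"
    using orthogonal_to_subspace_exists by blast
  define z where "z = w /\<^sub>R norm w"
  have z_norm: "z \<bullet> z = 1"
    using w(1) by (simp add: z_def dot_square_norm power2_eq_square)
  have z_orth: "z \<bullet> B = 0" "z \<bullet> D = 0"
    using w(2)[of B] w(2)[of D] by (simp_all add: z_def orthogonal_def span_base)
  define e where "e = (\<lambda>l. if l = i then z$1 else if l = j then z$2 else if l = k then z$3 else 0)"
  have sum_I: "(\<Sum>l\<in>I. f l) = f i + f j + f k" if "\<And>l. l \<notin> J \<Longrightarrow> f l = 0" for f :: "'i \<Rightarrow> real"
  proof -
    have "(\<Sum>l\<in>I. f l) = (\<Sum>l\<in>J. f l)"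
      using that \<open>J \<subseteq> I\<close> assms(1) by (intro sum.mono_neutral_right) auto
    then show ?thesis
      using J by (simp add: add.assoc)
  qed
  have e_J: "e l = 0" if "l \<notin> J" for l
    using that J by (auto simp: e_def)
  show thesis
  proof
    show "e l = 0" if "l \<notin> I" for l
      using that \<open>J \<subseteq> I\<close> by (intro e_J) auto
    show "(\<Sum>l\<in>I. (e l)\<^sup>2) = 1"
      using z_norm J
      by (subst sum_I) (auto simp: e_J e_def inner_vec_def sum_3 power2_eq_square)
    show "(\<Sum>l\<in>I. b l * e l) = 0"
      using z_orth(1) J
      by (subst sum_I) (auto simp: e_J e_def inner_vec_def sum_3 B_def mult.commute)
    show "(\<Sum>l\<in>I. d l * e l) = 0"
      using z_orth(2) J
      by (subst sum_I) (auto simp: e_J e_def inner_vec_def sum_3 D_def mult.commute)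
  qed
qed

definition sphere_section :: "'i set \<Rightarrow> ('i \<Rightarrow> real) \<Rightarrow> real \<Rightarrow> ('i \<Rightarrow> real) set" where
  "sphere_section I b c =
     {x. (\<forall>i. i \<notin> I \<longrightarrow> x i = 0) \<and> (\<Sum>i\<in>I. (x i)\<^sup>2) = 1 \<and> (\<Sum>i\<in>I. b i * x i) = c}"

text \<open>
  Let \<open>x\<close> and \<open>y\<close> have midpoint \<open>m\<close> and half-difference \<open>d\<close>, and let the unit vector \<open>e\<close> be orthogonal to
  \<open>b\<close> and \<open>d\<close>.  The plane through \<open>m\<close> spanned by \<open>d\<close> and \<open>e\<close> lies in the hyperplane and meets the sphere
  in a circle through \<open>x\<close> and \<open>y\<close>.  The half of this circle on the side of \<open>e\<close> is the graph of a square
  root over a diameter parallel to \<open>d\<close>.  Choosing the sign of \<open>e\<close> so that \<open>m \<bullet> e \<ge> 0\<close> puts both points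
  on that half, and the graph over the segment between them is the path.  Normalising
  the straight segment instead would fail when \<open>x\<close> and \<open>y\<close> are antipodal in the section.
\<close>

lemma path_connected_sphere_section:
  assumes "finite I" and "3 \<le> card I"
  shows "path_connected (sphere_section I b c)"
  unfolding path_connected_def
proof (intro ballI)
  fix x y
  assume x: "x \<in> sphere_section I b c" and y: "y \<in> sphere_section I b c"
  define m d where "m = (\<lambda>i. (x i + y i) / 2)" and "d = (\<lambda>i. (x i - y i) / 2)"
  have x_md: "x i = m i + d i" and y_md: "y i = m i - d i" for i
    by (simp_all add: m_def d_def field_simps)
  obtain e0 where e0: "\<And>i. i \<notin> I \<Longrightarrow> e0 i = 0" "(\<Sum>i\<in>I. (e0 i)\<^sup>2) = 1"
      "(\<Sum>i\<in>I. b i * e0 i) = 0" "(\<Sum>i\<in>I. d i * e0 i) = 0"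
    by (rule unit_vector_orthogonal_to_two[OF assms, of b d], rule that) simp_all
  define e where "e = (if 0 \<le> (\<Sum>i\<in>I. m i * e0 i) then e0 else (\<lambda>i. - e0 i))"
  have e: "\<And>i. i \<notin> I \<Longrightarrow> e i = 0" "(\<Sum>i\<in>I. (e i)\<^sup>2) = 1"
      "(\<Sum>i\<in>I. b i * e i) = 0" "(\<Sum>i\<in>I. d i * e i) = 0" "0 \<le> (\<Sum>i\<in>I. m i * e i)"
    using e0 by (auto simp: e_def sum_negf)
  define L where "L = (\<Sum>i\<in>I. m i * e i)"
  define D where "D = (\<Sum>i\<in>I. (d i)\<^sup>2)"
  have "0 \<le> D"
    by (simp add: D_def sum_nonneg)
  have "(\<Sum>i\<in>I. (x i)\<^sup>2) = (\<Sum>i\<in>I. (m i)\<^sup>2) + 2 * (\<Sum>i\<in>I. m i * d i) + D"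
    unfolding D_def sum_distrib_left sum.distrib[symmetric]
    by (intro sum.cong refl) (simp add: x_md power2_eq_square algebra_simps)
  moreover have "(\<Sum>i\<in>I. (y i)\<^sup>2) = (\<Sum>i\<in>I. (m i)\<^sup>2) - 2 * (\<Sum>i\<in>I. m i * d i) + D"
    unfolding D_def sum_distrib_left sum.distrib[symmetric] sum_subtractf[symmetric]
    by (intro sum.cong refl) (simp add: y_md power2_eq_square algebra_simps)
  ultimately have sq: "(\<Sum>i\<in>I. (m i)\<^sup>2) + D = 1" "(\<Sum>i\<in>I. m i * d i) = 0"
    using x y by (simp_all add: sphere_section_def)
  have "(\<Sum>i\<in>I. b i * x i) = (\<Sum>i\<in>I. b i * m i) + (\<Sum>i\<in>I. b i * d i)"
    and "(\<Sum>i\<in>I. b i * y i) = (\<Sum>i\<in>I. b i * m i) - (\<Sum>i\<in>I. b i * d i)"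
    by (simp_all add: x_md y_md distrib_left right_diff_distrib sum.distrib sum_subtractf)
  then have lin: "(\<Sum>i\<in>I. b i * m i) = c" "(\<Sum>i\<in>I. b i * d i) = 0"
    using x y by (simp_all add: sphere_section_def)
  have supp: "m i = 0" "d i = 0" if "i \<notin> I" for i
    using x y that by (auto simp: sphere_section_def m_def d_def)
  \<comment> \<open>The height \<open>r s\<close> is measured from \<open>m - L e\<close>, which is the centre of the circle because \<open>m\<close> is
     orthogonal to \<open>d\<close>; the squared radius is \<open>L\<^sup>2 + D\<close>.\<close>
  define r where "r = (\<lambda>s. sqrt (L\<^sup>2 + (1 - s\<^sup>2) * D))"
  define g where "g = (\<lambda>s i. m i + s * d i + (r s - L) * e i)"
  have g_in: "g s \<in> sphere_section I b c" if "s\<^sup>2 \<le> 1" for s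
  proof -
    have "(r s)\<^sup>2 = L\<^sup>2 + (1 - s\<^sup>2) * D"
      using that \<open>0 \<le> D\<close> by (simp add: r_def)
    moreover have "(\<Sum>i\<in>I. (g s i)\<^sup>2) =
        (\<Sum>i\<in>I. (m i)\<^sup>2) + s\<^sup>2 * D + (r s - L)\<^sup>2 * (\<Sum>i\<in>I. (e i)\<^sup>2)
        + 2 * s * (\<Sum>i\<in>I. m i * d i) + 2 * (r s - L) * (\<Sum>i\<in>I. m i * e i)
        + 2 * s * (r s - L) * (\<Sum>i\<in>I. d i * e i)"
      unfolding g_def D_def sum_distrib_left sum.distrib[symmetric]
      by (intro sum.cong refl) (simp add: power2_eq_square algebra_simps)
    then have "(\<Sum>i\<in>I. (g s i)\<^sup>2) = (\<Sum>i\<in>I. (m i)\<^sup>2) + s\<^sup>2 * D + (r s - L)\<^sup>2 + 2 * (r s - L) * L"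
      unfolding e(2,4) sq(2) L_def[symmetric] by simp
    ultimately have "(\<Sum>i\<in>I. (g s i)\<^sup>2) = 1"
      using sq(1) by (simp add: power2_eq_square algebra_simps)
    moreover have "(\<Sum>i\<in>I. b i * g s i) =
        (\<Sum>i\<in>I. b i * m i) + s * (\<Sum>i\<in>I. b i * d i) + (r s - L) * (\<Sum>i\<in>I. b i * e i)"
      unfolding g_def sum_distrib_left sum.distrib[symmetric]
      by (intro sum.cong refl) (simp add: algebra_simps)
    then have "(\<Sum>i\<in>I. b i * g s i) = c"
      using lin e(3) by simp
    ultimately show ?thesis
      using supp e(1) by (simp add: sphere_section_def g_def)
  qed
  have r_1: "r 1 = L" "r (-1) = L"
    using e(5) by (simp_all add: r_def L_def)
  have "continuous_on {0..1} (\<lambda>t. g (1 - 2 * t))"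
    unfolding g_def r_def by (intro continuous_intros)
  moreover have "(1 - 2 * t)\<^sup>2 \<le> 1" if "t \<in> {0..1}" for t :: real
    using that by (simp add: abs_square_le_1 abs_le_iff)
  ultimately have "path (\<lambda>t. g (1 - 2 * t))"
    and "path_image (\<lambda>t. g (1 - 2 * t)) \<subseteq> sphere_section I b c"
    using g_in by (auto simp: path_def path_image_def)
  moreover have "g 1 = x" "g (-1) = y"
    by (simp_all add: fun_eq_iff g_def r_1 x_md y_md)
  then have "pathstart (\<lambda>t. g (1 - 2 * t)) = x" "pathfinish (\<lambda>t. g (1 - 2 * t)) = y"
    by (simp_all add: pathstart_def pathfinish_def)
  ultimately show "\<exists>h. path h \<and> path_image h \<subseteq> sphere_section I b c \<and> pathstart h = x \<and> pathfinish h = y"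
    by blast
qed

section \<open>The hypersurface as an image of a product of spheres\<close>

text \<open>
  The coordinate \<open>t\<close> of \<open>(t, v)\<close> is stored at index \<open>p\<close>, so that \<open>v\<close> keeps the indices it has in the
  ambient space.
\<close>

definition radial_map :: "nat \<Rightarrow> real \<Rightarrow> (nat \<Rightarrow> real) \<times> (nat \<Rightarrow> real) \<Rightarrow> nat \<Rightarrow> real" where
  "radial_map p a = (\<lambda>(\<omega>, w) i. if i < p + 1 then sqrt (a\<^sup>2 + w p) * \<omega> i else w i)"

lemma continuous_on_radial_map: "continuous_on A (radial_map p a)"
proof (rule continuous_on_coordinatewise_then_product)
  fix i
  have coord: "continuous_on A (\<lambda>z. fst z j)" "continuous_on A (\<lambda>z. snd z j)" for j
    by (rule continuous_on_product_then_coordinatewise[OF continuous_on_fst[OF continuous_on_id]]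
          continuous_on_product_then_coordinatewise[OF continuous_on_snd[OF continuous_on_id]])+
  show "continuous_on A (\<lambda>z. radial_map p a z i)"
    by (cases "i < p + 1") (auto simp: radial_map_def case_prod_beta
        intro!: continuous_on_mult continuous_on_add continuous_on_real_sqrt continuous_on_const coord)
qed

text \<open>
  The condition \<open>\<beta> p = 0\<close> makes the second equation one on \<open>v\<close> alone.  The first one is homogeneous,
  so it survives the rescaling of \<open>\<omega>\<close>.
\<close>

lemma radial_map_image_sphere_sections:
  assumes "a > 1" and "\<beta> p = 0"
  shows "radial_map p a ` (sphere_section {..<p + 1} b 0 \<times> sphere_section {p..<p + q + 1} \<beta> c) =
    {x \<in> S_hypersurface p q a.
       (\<Sum>i<p + 1. b i * x i) = 0 \<and> (\<Sum>j=p + 1..<p + q + 1. \<beta> j * x j) = c}"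
    (is "_ ` (?A \<times> ?B) = ?R")
proof -
  have split: "(\<Sum>j=p..<p + q + 1. f j) = f p + (\<Sum>j=p + 1..<p + q + 1. f j)" for f :: "nat \<Rightarrow> real"
    by (simp add: sum.atLeast_Suc_lessThan)
  have pos: "0 < a\<^sup>2 + t" if "t\<^sup>2 \<le> 1" for t
  proof -
    have "-1 \<le> t"
      using that by (simp add: abs_square_le_1)
    moreover have "1 < a\<^sup>2"
      using \<open>a > 1\<close> by (simp add: one_less_power)
    ultimately show ?thesis
      by simp
  qed
  show ?thesis
  proof (intro equalityI subsetI)
    fix x
    assume "x \<in> radial_map p a ` (?A \<times> ?B)"
    then obtain \<omega> w where om: "\<omega> \<in> ?A" and w: "w \<in> ?B" and x: "x = radial_map p a (\<omega>, w)"
      by auto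
    have w_sq: "(w p)\<^sup>2 + (\<Sum>j=p + 1..<p + q + 1. (w j)\<^sup>2) = 1"
      using w unfolding sphere_section_def split by simp
    then have "(w p)\<^sup>2 \<le> 1"
      using sum_nonneg[of "{p + 1..<p + q + 1}" "\<lambda>j. (w j)\<^sup>2"] by simp
    then have rad: "0 < a\<^sup>2 + w p"
      by (rule pos)
    have low: "x i = sqrt (a\<^sup>2 + w p) * \<omega> i" if "i < p + 1" for i
      using that by (simp add: x radial_map_def)
    have high: "x j = w j" if "p + 1 \<le> j" for j
      using that by (simp add: x radial_map_def)
    have "(\<Sum>i<p + 1. (x i)\<^sup>2) = (\<Sum>i<p + 1. (a\<^sup>2 + w p) * (\<omega> i)\<^sup>2)"
      using rad by (intro sum.cong refl) (simp add: low power_mult_distrib)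
    also have "\<dots> = a\<^sup>2 + w p"
      unfolding sum_distrib_left[symmetric] using om by (simp add: sphere_section_def)
    finally have norm_u: "(\<Sum>i<p + 1. (x i)\<^sup>2) = a\<^sup>2 + w p" .
    have "(\<Sum>j=p + 1..<p + q + 1. (x j)\<^sup>2) = (\<Sum>j=p + 1..<p + q + 1. (w j)\<^sup>2)"
      by (intro sum.cong refl) (simp add: high)
    then have "((\<Sum>i<p + 1. (x i)\<^sup>2) - a\<^sup>2)\<^sup>2 + (\<Sum>j=p + 1..<p + q + 1. (x j)\<^sup>2) = 1"
      using w_sq unfolding norm_u by simp
    moreover have "x \<in> topspace (Euclidean_space (p + q + 1))"
      using w by (auto simp: topspace_Euclidean_space high sphere_section_def)
    moreover have "(\<Sum>i<p + 1. b i * x i) = sqrt (a\<^sup>2 + w p) * (\<Sum>i<p + 1. b i * \<omega> i)"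
      unfolding sum_distrib_left by (intro sum.cong refl) (simp add: low)
    then have "(\<Sum>i<p + 1. b i * x i) = 0"
      using om by (simp add: sphere_section_def)
    moreover have "(\<Sum>j=p + 1..<p + q + 1. \<beta> j * x j) = (\<Sum>j=p + 1..<p + q + 1. \<beta> j * w j)"
      by (intro sum.cong refl) (simp add: high)
    then have "(\<Sum>j=p + 1..<p + q + 1. \<beta> j * x j) = c"
      using w \<open>\<beta> p = 0\<close> unfolding sphere_section_def split by simp
    ultimately show "x \<in> ?R"
      by (simp add: S_hypersurface_def)
  next
    fix x
    assume x: "x \<in> ?R"
    define t where "t = (\<Sum>i<p + 1. (x i)\<^sup>2) - a\<^sup>2"
    have t_sq: "t\<^sup>2 + (\<Sum>j=p + 1..<p + q + 1. (x j)\<^sup>2) = 1"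
      using x unfolding S_hypersurface_def t_def by simp
    then have "t\<^sup>2 \<le> 1"
      using sum_nonneg[of "{p + 1..<p + q + 1}" "\<lambda>j. (x j)\<^sup>2"] by simp
    then have rad: "0 < a\<^sup>2 + t"
      by (rule pos)
    define \<omega> where "\<omega> = (\<lambda>i. if i < p + 1 then x i / sqrt (a\<^sup>2 + t) else 0)"
    define w where "w = (\<lambda>j. if j < p then 0 else if j = p then t else x j)"
    have "(\<Sum>i<p + 1. (\<omega> i)\<^sup>2) = (\<Sum>i<p + 1. (x i)\<^sup>2) / (a\<^sup>2 + t)"
      unfolding sum_divide_distrib using rad
      by (intro sum.cong refl) (simp add: \<omega>_def power_divide)
    then have "(\<Sum>i<p + 1. (\<omega> i)\<^sup>2) = 1"
      using rad by (simp add: t_def)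
    moreover have "(\<Sum>i<p + 1. b i * \<omega> i) = (\<Sum>i<p + 1. b i * x i) / sqrt (a\<^sup>2 + t)"
      unfolding sum_divide_distrib by (intro sum.cong refl) (simp add: \<omega>_def)
    then have "(\<Sum>i<p + 1. b i * \<omega> i) = 0"
      using x by simp
    ultimately have "\<omega> \<in> ?A"
      by (simp add: sphere_section_def \<omega>_def)
    moreover have "w \<in> ?B"
    proof -
      have "(\<Sum>j=p + 1..<p + q + 1. (w j)\<^sup>2) = (\<Sum>j=p + 1..<p + q + 1. (x j)\<^sup>2)"
        and "(\<Sum>j=p + 1..<p + q + 1. \<beta> j * w j) = (\<Sum>j=p + 1..<p + q + 1. \<beta> j * x j)"
        by (intro sum.cong refl; simp add: w_def)+
      moreover have "w p = t"
        by (simp add: w_def)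
      ultimately have "(\<Sum>j=p..<p + q + 1. (w j)\<^sup>2) = 1" "(\<Sum>j=p..<p + q + 1. \<beta> j * w j) = c"
        unfolding split using x t_sq \<open>\<beta> p = 0\<close> by simp_all
      moreover have "w j = 0" if "j \<notin> {p..<p + q + 1}" for j
        using that x by (auto simp: w_def S_hypersurface_def topspace_Euclidean_space)
      ultimately show ?thesis
        by (simp add: sphere_section_def)
    qed
    moreover have "x = radial_map p a (\<omega>, w)"
      using rad by (auto simp: radial_map_def \<omega>_def w_def fun_eq_iff)
    ultimately show "x \<in> radial_map p a ` (?A \<times> ?B)"
      by blast
  qed
qed

lemma path_connectedin_hypersurface_section:
  assumes "p \<ge> 2" and "q \<ge> 2" and "a > 1" and "\<beta> p = 0"
  shows "path_connectedin (Euclidean_space (p + q + 1))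
    {x \<in> S_hypersurface p q a.
       (\<Sum>i<p + 1. b i * x i) = 0 \<and> (\<Sum>j=p + 1..<p + q + 1. \<beta> j * x j) = c}"
    (is "path_connectedin _ ?R")
proof -
  have "path_connected (sphere_section {..<p + 1} b 0 \<times> sphere_section {p..<p + q + 1} \<beta> c)"
    using assms(1,2) by (intro path_connected_Times path_connected_sphere_section) auto
  then have "path_connected ?R"
    unfolding radial_map_image_sphere_sections[of a \<beta> p b q c, OF assms(3,4), symmetric]
    by (intro path_connected_continuous_image continuous_on_radial_map)
  moreover have "?R \<subseteq> {x. \<forall>i\<ge>p + q + 1. x i = 0}"
    by (auto simp: S_hypersurface_def topspace_Euclidean_space)
  ultimately show ?thesis
    unfolding Euclidean_space_def path_connectedin_subtopology euclidean_product_topology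
      path_connectedin_euclidean
    by blast
qed

theorem proposition4p2:
  fixes p q n :: nat and a :: real
  assumes "p \<ge> 2" and "q \<ge> 2" and "n = p + q + 1" and "a > 1"
  shows "(\<forall>M. is_meridian p q a M \<longrightarrow> path_connectedin (Euclidean_space n) M) \<and>
         (\<forall>P. is_parallel p q a P \<longrightarrow> path_connectedin (Euclidean_space n) P)"
proof (intro conjI allI impI)
  fix M
  assume "is_meridian p q a M"
  then obtain b where "M = S_hypersurface p q a \<inter>
      {x \<in> topspace (Euclidean_space (p + q + 1)). (\<Sum>i<p + 1. b i * x i) = 0}"
    by (auto simp: is_meridian_def)
  then have "M = {x \<in> S_hypersurface p q a.
      (\<Sum>i<p + 1. b i * x i) = 0 \<and> (\<Sum>j=p + 1..<p + q + 1. 0 * x j) = 0}"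
    by (auto simp: S_hypersurface_def)
  then show "path_connectedin (Euclidean_space n) M"
    using path_connectedin_hypersurface_section[of p q a "\<lambda>_. 0" b 0] assms by simp
next
  fix P
  assume "is_parallel p q a P"
  then obtain b c where P: "P = S_hypersurface p q a \<inter>
      {x \<in> topspace (Euclidean_space (p + q + 1)). (\<Sum>j=p + 1..<p + q + 1. b j * x j) - c = 0}"
    unfolding is_parallel_def by blast
  \<comment> \<open>Index \<open>p\<close> is the place of \<open>t\<close> in \<open>(t, v)\<close>, so the coefficient there has to vanish.\<close>
  define \<beta> where "\<beta> = b(p := 0)"
  have "(\<Sum>j=p + 1..<p + q + 1. \<beta> j * x j) = (\<Sum>j=p + 1..<p + q + 1. b j * x j)" for x
    by (intro sum.cong refl) (simp add: \<beta>_def)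
  then have "P = {x \<in> S_hypersurface p q a.
      (\<Sum>i<p + 1. 0 * x i) = 0 \<and> (\<Sum>j=p + 1..<p + q + 1. \<beta> j * x j) = c}"
    unfolding P by (auto simp: S_hypersurface_def)
  then show "path_connectedin (Euclidean_space n) P"
    using path_connectedin_hypersurface_section[of p q a \<beta> "\<lambda>_. 0" c] assms
    by (simp add: \<beta>_def)
qed

end
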